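(* Let $a>0$ and $b>0$. On $(0,\infty)$: (i) $$\sqrt{\tfrac{2}{\pi}}\int e^{-ax^{2}}b^{\frac32}x^{-1+\frac12}K_{\frac32}(bx)\,dx=b\int\frac1x\left(\frac{1}{bx}+1\right)e^{-ax^{2}-bx}\,dx=-\sqrt{a}\sqrt{\pi}\,e^{\frac{b^{2}}{4a}}\operatorname{erf}\left(\frac{2ax+b}{2\sqrt a}\right)-\frac{e^{-ax^{2}-bx}}{x};$$ (ii) $$\sqrt{\tfrac{2}{\pi}}\int e^{-ax^{2}}b^{\frac32}x^{1+\frac12}K_{\frac32}(bx)\,dx=b\int x\left(\frac{1}{bx}+1\right)e^{-ax^{2}-bx}\,dx=\frac{\sqrt\pi\,(2a-b^{2})e^{\frac{b^{2}}{4a}}\operatorname{erf}\left(\frac{2ax+b}{2\sqrt a}\right)}{4a^{3/2}}-\frac{b\,e^{-ax^{2}-bx}}{2a}.$$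
   Context: $K_\mu$ is the Macdonald function (modified Bessel function of the second kind); $\operatorname{erf}(z)=\frac{2}{\sqrt\pi}\int_0^z e^{-t^2}dt$. An identity $\int f\,dx=\int g\,dx=F$ means that $f=g$ on $(0,\infty)$ and that $F$ is an antiderivative of this function on $(0,\infty)$. *)

theory Defs
  imports "HOL-Analysis.Analysis"
begin

text \<open>
  Modified Bessel function of the first kind, of real order and positive real argument. The
  reciprocal Gamma function makes the terms at the poles of Gamma vanish, as they should.
\<close>

definition bessel_I :: "real \<Rightarrow> real \<Rightarrow> real" where
  "bessel_I \<mu> x = (\<Sum>k. (x / 2) powr (2 * real k + \<mu>) / fact k * rGamma (real k + \<mu> + 1))"

definition macdonald_quotient :: "real \<Rightarrow> real \<Rightarrow> real" where
  "macdonald_quotient \<mu> x = pi / 2 * (bessel_I (- \<mu>) x - bessel_I \<mu> x) / sin (\<mu> * pi)"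

text \<open>
  The Macdonald function. At integer order the quotient degenerates to the form 0/0, and the
  function is its limit in the order.
\<close>

definition macdonald_K :: "real \<Rightarrow> real \<Rightarrow> real" where
  "macdonald_K \<mu> x =
     (if \<mu> \<in> \<int> then Lim (at \<mu>) (\<lambda>\<nu>. macdonald_quotient \<nu> x) else macdonald_quotient \<mu> x)"

text \<open>The interval integral is oriented, so this is also correct for negative arguments.\<close>

definition erf :: "real \<Rightarrow> real" where
  "erf z = 2 / sqrt pi * (LBINT t=0..z. exp (- (t\<^sup>2)))"

end

(*
  The half-integer values of the Gamma function turn the power series of I_{3/2} and I_{-3/2} into
  combinations of those of cosh and sinh, so K_{3/2}(x) = sqrt (pi / (2 x)) exp (-x) (1 + 1/x).
  The antiderivatives are then verified by differentiation, completing the square in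
  exp (b^2 / (4 a)) * exp (- ((2 a x + b) / (2 sqrt a))^2) = exp (- a x^2 - b x).
*)
theory Submission
  imports Defs
begin

section \<open>The error function and its derivative\<close>

lemma erf_has_real_derivative:
  "(erf has_real_derivative 2 / sqrt pi * exp (- z\<^sup>2)) (at z)"
proof -
  \<comment> \<open>The fundamental theorem of calculus is applied on a compact interval. This
    radius puts both the base point 0 and \<open>z\<close> in its interior, so the derivative within
    the interval is a full derivative.\<close>
  define r where "r = \<bar>z\<bar> + 1"
  have "((\<lambda>u. LBINT t=ereal 0..u. exp (- (t\<^sup>2))) has_vector_derivative exp (- z\<^sup>2))
          (at z within {- r..r})"
    by (rule interval_integral_FTC2) (auto simp: r_def intro!: continuous_intros)
  moreover have "at z within {- r..r} = at z"
    by (rule at_within_interior) (auto simp: r_def)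
  ultimately have "((\<lambda>u. LBINT t=0..u. exp (- (t\<^sup>2))) has_real_derivative exp (- z\<^sup>2)) (at z)"
    by (simp add: has_real_derivative_iff_has_vector_derivative zero_ereal_def)
  then have "((\<lambda>z. 2 / sqrt pi * (LBINT t=0..z. exp (- (t\<^sup>2)))) has_real_derivative
               2 / sqrt pi * exp (- z\<^sup>2)) (at z)"
    by (rule DERIV_cmult)
  then show ?thesis
    by (simp add: erf_def [abs_def])
qed

section \<open>Hyperbolic power series and half-integer values of the Gamma function\<close>

lemma cosh_sums: "(\<lambda>k. x ^ (2 * k) / fact (2 * k)) sums cosh x" for x :: real
proof -
  have "(\<lambda>k. (if even (2 * k) then x ^ (2 * k) /\<^sub>R fact (2 * k) else 0)) sums cosh x"
    \<comment> \<open>The full series has zeros at the odd indices, so summing along the strictly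
      increasing index map \<open>2 * k\<close> loses nothing.\<close>
    by (rule sums_mono_reindex[THEN iffD2, OF _ _ cosh_converges])
       (auto simp: strict_mono_def elim!: evenE)
  then show ?thesis
    by (simp add: divide_inverse mult.commute)
qed

lemma sinh_sums: "(\<lambda>k. x ^ (2 * k + 1) / fact (2 * k + 1)) sums sinh x" for x :: real
proof -
  have "(\<lambda>k. (if even (2 * k + 1) then 0 else x ^ (2 * k + 1) /\<^sub>R fact (2 * k + 1))) sums sinh x"
    by (rule sums_mono_reindex[THEN iffD2, OF _ _ sinh_converges])
       (auto simp: strict_mono_def elim!: oddE)
  then show ?thesis
    by (simp add: divide_inverse mult.commute del: fact_Suc power_Suc)
qed

text \<open>Induction from \<open>Gamma (1/2) = sqrt pi\<close>: each step divides by
  \<open>k + 1/2\<close>, and this matches (2k+2)! = (k + 1/2) * 4(k + 1) * (2k)!.\<close>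

lemma rGamma_half_integer:
  "rGamma (real k + 1/2) = 4 ^ k * fact k / (fact (2 * k) * sqrt pi)"
proof (induction k)
  case 0
  show ?case by (simp add: rGamma_inverse_Gamma Gamma_one_half_real inverse_eq_divide)
next
  case (Suc k)
  have "(real k + 1/2) * rGamma (real (Suc k) + 1/2) = rGamma (real k + 1/2)"
    using rGamma_plus1[of "real k + 1/2"] by (simp add: algebra_simps)
  then have "rGamma (real (Suc k) + 1/2) = rGamma (real k + 1/2) / (real k + 1/2)"
    by (simp add: field_simps)
  moreover have "fact (2 * Suc k) = (real k + 1/2) * (4 * real (Suc k)) * fact (2 * k)"
    by (simp add: algebra_simps)
  moreover have "fact (Suc k) = real (Suc k) * fact k"
    by simp
  \<comment> \<open>Free variables stand for the factorials and \<open>sqrt pi\<close>, so that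
    simplification cannot unfold them while the factor \<open>c\<close> (later \<open>k + 1\<close>)
    cancels.\<close>
  moreover have "4 ^ k * m / (n * s) / h = 4 ^ Suc k * (c * m) / (h * (4 * c) * n * s)"
    if "c \<noteq> 0" "h \<noteq> 0" for c h m n s :: real
    using that by (simp add: divide_simps)
  from this[of "real (Suc k)" "real k + 1/2"]
  have "4 ^ k * fact k / (fact (2 * k) * sqrt pi) / (real k + 1/2) = 4 ^ Suc k * (real (Suc k) * fact k)
      / ((real k + 1/2) * (4 * real (Suc k)) * fact (2 * k) * sqrt pi)"
    by simp
  ultimately show ?case
    by (simp only: Suc.IH)
qed

section \<open>Modified Bessel and Macdonald functions at order 3/2\<close>

lemma powr_three_halves:
  fixes x :: real
  assumes "x > 0"
  shows "x powr (3/2) = x * sqrt x" "x powr (- (3/2)) = 1 / (x * sqrt x)"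
proof -
  show *: "x powr (3/2) = x * sqrt x"
    using assms powr_add[of x 1 "1/2"] by (simp add: powr_half_sqrt)
  show "x powr (- (3/2)) = 1 / (x * sqrt x)"
    by (simp add: powr_minus_divide *)
qed

text \<open>After \<open>fact k\<close> and \<open>4 ^ k\<close> cancel, the terms are those of the
  cosh series weighted by (2k - 1)/2. The weight 2k acts as x d/dx and yields x sinh x; the weight
  -1 yields -cosh x.\<close>

lemma bessel_I_minus_three_halves:
  assumes "x > 0"
  shows "bessel_I (- (3/2)) x = sqrt (2 / (pi * x)) * (sinh x - cosh x / x)"
proof -
  have "(\<lambda>k. x * (x ^ (2 * k + 1) / fact (2 * k + 1))) sums (x * sinh x)"
    by (intro sums_mult sinh_sums)
  moreover have "x * (x ^ (2 * k + 1) / fact (2 * k + 1))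
      = 2 * real (Suc k) * (x ^ (2 * Suc k) / fact (2 * Suc k))" for k
    by (simp add: divide_simps)
  ultimately have "(\<lambda>k. 2 * real (Suc k) * (x ^ (2 * Suc k) / fact (2 * Suc k))) sums (x * sinh x)"
    by simp
  \<comment> \<open>The weight 2k kills the term at index 0, so shifting the index back leaves the
    sum unchanged.\<close>
  from sums_Suc[OF this]
  have "(\<lambda>k. 2 * real k * (x ^ (2 * k) / fact (2 * k))) sums (x * sinh x)"
    by simp
  from sums_mult[OF sums_divide[OF sums_diff[OF this cosh_sums[of x]], where c = 2],
      where c = "(x / 2) powr (- (3/2)) / sqrt pi"]
  have "(\<lambda>k. (x / 2) powr (- (3/2)) / sqrt pi *
          ((2 * real k * (x ^ (2 * k) / fact (2 * k)) - x ^ (2 * k) / fact (2 * k)) / 2))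
        sums ((x / 2) powr (- (3/2)) / sqrt pi * ((x * sinh x - cosh x) / 2))" .
  moreover have "(x / 2) powr (2 * real k + - (3/2)) / fact k * rGamma (real k + - (3/2) + 1)
      = (x / 2) powr (- (3/2)) / sqrt pi *
          ((2 * real k * (x ^ (2 * k) / fact (2 * k)) - x ^ (2 * k) / fact (2 * k)) / 2)" for k
  proof -
    have *: "rGamma (real k + - (3/2) + 1) = (real k - 1/2) * rGamma (real k + 1/2)"
      using rGamma_plus1[of "real k - 1/2"] by (simp add: algebra_simps)
    have **: "(x / 2) powr (2 * real k + - (3/2)) = x ^ (2 * k) / 4 ^ k * (x / 2) powr (- (3/2))"
      using assms powr_realpow[of "x / 2" "2 * k"] powr_add[of "x / 2" "2 * real k" "- (3/2)"]
      by (simp add: power_divide power_mult)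
    show ?thesis
      unfolding * ** rGamma_half_integer by (simp add: divide_simps) (simp add: algebra_simps)
  qed
  ultimately have "bessel_I (- (3/2)) x
      = (x / 2) powr (- (3/2)) / sqrt pi * ((x * sinh x - cosh x) / 2)"
    unfolding bessel_I_def by (simp add: sums_iff)
  also have "(x / 2) powr (- (3/2)) = 2 / x * (sqrt 2 / sqrt x)"
    using assms by (simp add: powr_three_halves real_sqrt_divide)
  also have "2 / x * (sqrt 2 / sqrt x) / sqrt pi * ((x * sinh x - cosh x) / 2)
      = sqrt 2 / (sqrt pi * sqrt x) * (sinh x - cosh x / x)"
    using assms by (simp add: divide_simps)
  finally show ?thesis
    by (simp add: real_sqrt_divide real_sqrt_mult)
qed

text \<open>The reciprocal Gamma factor splits into a difference of two reciprocal factorials, so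
  the series is a difference of the cosh and sinh series, each without its first term.\<close>

lemma bessel_I_three_halves:
  assumes "x > 0"
  shows "bessel_I (3/2) x = sqrt (2 / (pi * x)) * (cosh x - sinh x / x)"
proof -
  have "(\<lambda>k. x ^ (2 * Suc k) / fact (2 * Suc k)) sums (cosh x - 1)"
    by (subst sums_Suc_iff) (use cosh_sums[of x] in simp)
  moreover have "(\<lambda>k. x ^ (2 * Suc k + 1) / fact (2 * Suc k + 1)) sums (sinh x - x)"
    by (subst sums_Suc_iff[where f = "\<lambda>k. x ^ (2 * k + 1) / fact (2 * k + 1)"])
       (use sinh_sums[of x] in simp)
  ultimately have "(\<lambda>k. (x / 2) powr (3/2) / sqrt pi * (4 *
      (x ^ (2 * Suc k) / fact (2 * Suc k) / x\<^sup>2 - x ^ (2 * Suc k + 1) / fact (2 * Suc k + 1) / x ^ 3)))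
    sums ((x / 2) powr (3/2) / sqrt pi * (4 * ((cosh x - 1) / x\<^sup>2 - (sinh x - x) / x ^ 3)))"
    by (intro sums_mult sums_diff sums_divide)
  moreover have "(x / 2) powr (2 * real k + 3/2) / fact k * rGamma (real k + 3/2 + 1)
      = (x / 2) powr (3/2) / sqrt pi * (4 *
      (x ^ (2 * Suc k) / fact (2 * Suc k) / x\<^sup>2 - x ^ (2 * Suc k + 1) / fact (2 * Suc k + 1) / x ^ 3))"
    for k
  proof -
    have pos: "real k + 1/2 > 0" "real k + 3/2 > 0" by simp_all
    have "rGamma (real k + 1/2) = (real k + 1/2) * ((real k + 3/2) * rGamma (real k + 3/2 + 1))"
      using rGamma_plus1[of "real k + 1/2"] rGamma_plus1[of "real k + 3/2"]
      by (simp add: algebra_simps)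
    then have "rGamma (real k + 3/2 + 1)
        = rGamma (real k + 1/2) / ((real k + 1/2) * (real k + 3/2))"
      using pos by (simp add: mult.assoc)
    \<comment> \<open>The split rests on 1/(2k+2)! - 1/(2k+3)! = 1/((2k+1)(2k+3)(2k)!).\<close>
    also have "\<dots> = 4 ^ k * fact k / sqrt pi *
        (4 * (1 / fact (2 * Suc k) - 1 / fact (2 * Suc k + 1)))"
      unfolding rGamma_half_integer
      by (simp add: divide_simps add_nonneg_eq_0_iff) (simp add: algebra_simps)
    finally have *: "rGamma (real k + 3/2 + 1) = 4 ^ k * fact k / sqrt pi *
        (4 * (1 / fact (2 * Suc k) - 1 / fact (2 * Suc k + 1)))" .
    have **: "(x / 2) powr (2 * real k + 3/2) = x ^ (2 * k) / 4 ^ k * (x / 2) powr (3/2)"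
      using assms powr_realpow[of "x / 2" "2 * k"]
      by (simp add: powr_add power_divide power_mult)
    have ***: "x ^ (2 * Suc k) / m / x\<^sup>2 = x ^ (2 * k) * (1 / m)"
      "x ^ (2 * Suc k + 1) / m / x ^ 3 = x ^ (2 * k) * (1 / m)" for m
      using assms by (simp_all add: power2_eq_square power3_eq_cube)
    show ?thesis
      unfolding * ** *** by (simp add: right_diff_distrib mult_ac del: fact_Suc mult_Suc_right)
  qed
  ultimately have "bessel_I (3/2) x
      = (x / 2) powr (3/2) / sqrt pi * (4 * ((cosh x - 1) / x\<^sup>2 - (sinh x - x) / x ^ 3))"
    unfolding bessel_I_def by (simp add: sums_iff)
  \<comment> \<open>The corrections for the missing first terms cancel: -1/x^2 + x/x^3 = 0.\<close>
  also have "4 * ((cosh x - 1) / x\<^sup>2 - (sinh x - x) / x ^ 3) = 4 / x\<^sup>2 * (cosh x - sinh x / x)"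
    using assms by (simp add: field_simps power2_eq_square power3_eq_cube)
  also have "(x / 2) powr (3/2) = x\<^sup>2 / 4 * (sqrt 2 / sqrt x)"
  proof -
    have "(x / 2) powr (3/2) = x / 2 * (sqrt x / sqrt 2)"
      using assms by (simp add: powr_three_halves real_sqrt_divide)
    also have "sqrt x / sqrt 2 = x / 2 * (sqrt 2 / sqrt x)"
      using assms by (simp add: field_simps)
    finally show ?thesis
      by (simp add: power2_eq_square)
  qed
  also have "x\<^sup>2 / 4 * (sqrt 2 / sqrt x) / sqrt pi * (4 / x\<^sup>2 * (cosh x - sinh x / x))
      = sqrt 2 / (sqrt pi * sqrt x) * (cosh x - sinh x / x)"
    using assms by (simp add: divide_simps)
  finally show ?thesis
    by (simp add: real_sqrt_divide real_sqrt_mult)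
qed

text \<open>The order is not an integer, so the quotient applies without a limit; sin(3 pi/2) = -1
  reverses the difference of the two Bessel functions.\<close>

lemma macdonald_K_three_halves:
  assumes "x > 0"
  shows "macdonald_K (3/2) x = sqrt (pi / 2) * exp (- x) * (1 + 1 / x) / sqrt x"
proof -
  have "(3/2 :: real) \<notin> \<int>"
  proof
    assume "(3/2 :: real) \<in> \<int>"
    then obtain n where "3/2 = real_of_int n" by (auto elim: Ints_cases)
    then have "3 = 2 * n" by linarith
    then show False by presburger
  qed
  moreover have "sin (3/2 * pi) = - 1"
    using sin_3over2_pi by simp
  ultimately have "macdonald_K (3/2) x = pi / 2 * (bessel_I (3/2) x - bessel_I (- (3/2)) x)"
    by (simp add: macdonald_K_def macdonald_quotient_def algebra_simps)
  \<comment> \<open>The common prefactor leaves (cosh x - sinh x / x) - (sinh x - cosh x / x), which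
    factors.\<close>
  also have "\<dots> = pi / 2 * sqrt (2 / (pi * x)) * ((cosh x - sinh x) * (1 + 1 / x))"
    unfolding bessel_I_three_halves[OF assms] bessel_I_minus_three_halves[OF assms]
    by (simp add: algebra_simps add_divide_distrib diff_divide_distrib)
  also have "cosh x - sinh x = exp (- x)"
    by (rule cosh_minus_sinh)
  also have "pi / 2 * sqrt (2 / (pi * x)) = sqrt (pi / 2) / sqrt x"
  proof -
    have "pi / 2 * sqrt (2 / (pi * x)) = sqrt ((pi / 2)\<^sup>2) * sqrt (2 / (pi * x))"
      by simp
    also have "\<dots> = sqrt ((pi / 2)\<^sup>2 * (2 / (pi * x)))"
      by (simp only: real_sqrt_mult)
    also have "(pi / 2)\<^sup>2 * (2 / (pi * x)) = pi / 2 / x"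
      using assms by (simp add: field_simps power2_eq_square)
    finally show ?thesis
      by (simp only: real_sqrt_divide)
  qed
  finally show ?thesis
    by simp
qed

section \<open>The antiderivatives\<close>

lemma completed_square_erf_has_real_derivative:
  assumes "a > 0"
  shows "((\<lambda>x. exp (b\<^sup>2 / (4 * a)) * erf ((2 * a * x + b) / (2 * sqrt a))) has_real_derivative
           2 * sqrt a / sqrt pi * exp (- a * x\<^sup>2 - b * x)) (at x)"
proof -
  \<comment> \<open>The inner slope is 2a / (2 sqrt a) = sqrt a.\<close>
  have "((\<lambda>x. (2 * a * x + b) / (2 * sqrt a)) has_real_derivative sqrt a) (at x)"
    using assms by (auto intro!: derivative_eq_intros simp: real_div_sqrt)
  from DERIV_cmult[OF DERIV_chain2[OF erf_has_real_derivative this], of "exp (b\<^sup>2 / (4 * a))"]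
  have "((\<lambda>x. exp (b\<^sup>2 / (4 * a)) * erf ((2 * a * x + b) / (2 * sqrt a))) has_real_derivative
         exp (b\<^sup>2 / (4 * a)) * (2 / sqrt pi * exp (- ((2 * a * x + b) / (2 * sqrt a))\<^sup>2) * sqrt a)) (at x)" .
  moreover have "- a * x\<^sup>2 - b * x = b\<^sup>2 / (4 * a) + - ((2 * a * x + b) / (2 * sqrt a))\<^sup>2"
    using assms by (simp add: power_divide power_mult_distrib) (simp add: field_simps power2_eq_square)
  then have "exp (- a * x\<^sup>2 - b * x) = exp (b\<^sup>2 / (4 * a)) * exp (- ((2 * a * x + b) / (2 * sqrt a))\<^sup>2)"
    by (metis exp_add)
  ultimately show ?thesis
    by (simp add: mult_ac)
qed

theorem mainTheorem2:
  fixes a b :: real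
  assumes "a > 0" and "b > 0"
  shows
    "(\<forall>x>0.
        sqrt (2 / pi) * (exp (- a * x\<^sup>2) * b powr (3/2) * x powr (-1 + 1/2) * macdonald_K (3/2) (b * x))
          = b * (1 / x * (1 / (b * x) + 1) * exp (- a * x\<^sup>2 - b * x))
      \<and> ((\<lambda>x. - sqrt a * sqrt pi * exp (b\<^sup>2 / (4 * a)) * erf ((2 * a * x + b) / (2 * sqrt a))
               - exp (- a * x\<^sup>2 - b * x) / x)
          has_real_derivative b * (1 / x * (1 / (b * x) + 1) * exp (- a * x\<^sup>2 - b * x))) (at x))
   \<and> (\<forall>x>0.
        sqrt (2 / pi) * (exp (- a * x\<^sup>2) * b powr (3/2) * x powr (1 + 1/2) * macdonald_K (3/2) (b * x))
          = b * (x * (1 / (b * x) + 1) * exp (- a * x\<^sup>2 - b * x))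
      \<and> ((\<lambda>x. sqrt pi * (2 * a - b\<^sup>2) * exp (b\<^sup>2 / (4 * a)) * erf ((2 * a * x + b) / (2 * sqrt a))
                 / (4 * a powr (3/2))
               - b * exp (- a * x\<^sup>2 - b * x) / (2 * a))
          has_real_derivative b * (x * (1 / (b * x) + 1) * exp (- a * x\<^sup>2 - b * x))) (at x))"
proof (intro conjI allI impI)
  fix x :: real
  assume "x > 0"
  define E where "E = exp (- a * x\<^sup>2 - b * x)"
  \<comment> \<open>The factor \<open>p\<close> stands for either power of \<open>x\<close>, so one
    computation serves both integrand identities; \<open>macdonald_K\<close> contributes the
    division by \<open>sqrt x\<close>.\<close>
  have K: "sqrt (2 / pi) * (exp (- a * x\<^sup>2) * b powr (3/2) * p * macdonald_K (3/2) (b * x))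
      = b * (p / sqrt x * (1 / (b * x) + 1) * exp (- a * x\<^sup>2 - b * x))" for p
  proof -
    have "sqrt (2 / pi) * sqrt (pi / 2) = 1"
      by (simp add: real_sqrt_mult[symmetric])
    moreover have "exp (- a * x\<^sup>2 - b * x) = exp (- a * x\<^sup>2) * exp (- (b * x))"
      by (simp add: exp_add[symmetric])
    moreover have "sqrt (2 / pi) * (exp (- a * x\<^sup>2) * b powr (3/2) * p * macdonald_K (3/2) (b * x))
      = (sqrt (2 / pi) * sqrt (pi / 2)) * (b * (p / sqrt x * (1 / (b * x) + 1)
          * (exp (- a * x\<^sup>2) * exp (- (b * x)))))"
      using assms \<open>x > 0\<close>
      by (simp add: macdonald_K_three_halves powr_three_halves real_sqrt_mult add.commute)
    ultimately show ?thesis by simp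
  qed
  have erf': "((\<lambda>x. exp (b\<^sup>2 / (4 * a)) * erf ((2 * a * x + b) / (2 * sqrt a)))
      has_real_derivative 2 * sqrt a / sqrt pi * E) (at x)"
    unfolding E_def by (rule completed_square_erf_has_real_derivative) fact
  have E': "((\<lambda>x. exp (- a * x\<^sup>2 - b * x)) has_real_derivative (- 2 * a * x - b) * E) (at x)"
    unfolding E_def by (auto intro!: derivative_eq_intros)

  show "sqrt (2 / pi) * (exp (- a * x\<^sup>2) * b powr (3/2) * x powr (-1 + 1/2) * macdonald_K (3/2) (b * x))
          = b * (1 / x * (1 / (b * x) + 1) * exp (- a * x\<^sup>2 - b * x))"
  proof -
    have "x powr (-1 + 1/2) / sqrt x = 1 / x"
      using \<open>x > 0\<close> by (simp add: powr_minus_divide powr_half_sqrt)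
    then show ?thesis by (simp only: K)
  qed
  show "sqrt (2 / pi) * (exp (- a * x\<^sup>2) * b powr (3/2) * x powr (1 + 1/2) * macdonald_K (3/2) (b * x))
          = b * (x * (1 / (b * x) + 1) * exp (- a * x\<^sup>2 - b * x))"
  proof -
    have "x powr (1 + 1/2) / sqrt x = x"
      using \<open>x > 0\<close> by (simp add: powr_three_halves)
    then show ?thesis by (simp only: K)
  qed
  show "((\<lambda>x. - sqrt a * sqrt pi * exp (b\<^sup>2 / (4 * a)) * erf ((2 * a * x + b) / (2 * sqrt a))
               - exp (- a * x\<^sup>2 - b * x) / x)
          has_real_derivative b * (1 / x * (1 / (b * x) + 1) * exp (- a * x\<^sup>2 - b * x))) (at x)"
  proof -
    have "((\<lambda>x. - sqrt a * sqrt pi * (exp (b\<^sup>2 / (4 * a)) * erf ((2 * a * x + b) / (2 * sqrt a)))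
               - exp (- a * x\<^sup>2 - b * x) / x)
          has_real_derivative - sqrt a * sqrt pi * (2 * sqrt a / sqrt pi * E)
               - ((- 2 * a * x - b) * E * x - E * 1) / (x * x)) (at x)"
      using \<open>x > 0\<close> unfolding E_def
      by (intro DERIV_diff DERIV_cmult DERIV_divide DERIV_ident erf'[unfolded E_def] E'[unfolded E_def])
         simp
    \<comment> \<open>This term cancels the \<open>2 * a * E\<close> produced by the quotient rule;
      what remains is (b/x + 1/x^2) \<open>E\<close>.\<close>
    also have "- sqrt a * sqrt pi * (2 * sqrt a / sqrt pi * E) = - 2 * a * E"
      using assms by simp
    also have "- 2 * a * E - ((- 2 * a * x - b) * E * x - E * 1) / (x * x)
        = b * (1 / x * (1 / (b * x) + 1) * E)"
      using assms \<open>x > 0\<close> by (simp add: field_simps)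
    finally show ?thesis by (simp add: E_def mult.assoc)
  qed
  show "((\<lambda>x. sqrt pi * (2 * a - b\<^sup>2) * exp (b\<^sup>2 / (4 * a)) * erf ((2 * a * x + b) / (2 * sqrt a))
                 / (4 * a powr (3/2))
               - b * exp (- a * x\<^sup>2 - b * x) / (2 * a))
          has_real_derivative b * (x * (1 / (b * x) + 1) * exp (- a * x\<^sup>2 - b * x))) (at x)"
  proof -
    have "((\<lambda>x. sqrt pi * (2 * a - b\<^sup>2) * (exp (b\<^sup>2 / (4 * a)) * erf ((2 * a * x + b) / (2 * sqrt a)))
                 / (4 * a powr (3/2))
               - b * exp (- a * x\<^sup>2 - b * x) / (2 * a))
          has_real_derivative sqrt pi * (2 * a - b\<^sup>2) * (2 * sqrt a / sqrt pi * E) / (4 * a powr (3/2))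
               - b * ((- 2 * a * x - b) * E) / (2 * a)) (at x)"
      by (intro DERIV_diff DERIV_cdivide DERIV_cmult erf' E')
    \<comment> \<open>The erf term contributes (1 - b^2/(2a)) \<open>E\<close> and the exponential
      term (b x + b^2/(2a)) \<open>E\<close>. The b^2 parts cancel, leaving (1 + b x)
      \<open>E\<close>.\<close>
    also have "sqrt pi * (2 * a - b\<^sup>2) * (2 * sqrt a / sqrt pi * E) / (4 * a powr (3/2))
        = (2 * a - b\<^sup>2) * E / (2 * a)"
      using assms by (simp add: powr_three_halves)
    also have "(2 * a - b\<^sup>2) * E / (2 * a) - b * ((- 2 * a * x - b) * E) / (2 * a)
        = b * (x * (1 / (b * x) + 1) * E)"
      using assms \<open>x > 0\<close> by (simp add: field_simps power2_eq_square)
    finally show ?thesis by (simp add: E_def mult.assoc)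
  qed
qed

end
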